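(* Let $\eta:A^*\to A^*$ be a substitution and $u\in A^{\mathbb{Z}}$ a two-sided periodic point of $\eta$ with growing seed $s=u_{-1}|u_0$, and let $p\ge1$ be the period of $u$. Let $f:\mathbb{Z}\to\{0,1\}\mathcal{D}^*$ be a map. The following are equivalent: (1) $f=\mathrm{rep}_u$; (2) $f$ is increasing with respect to $\prec$, its image is $f(\mathbb{Z})=\bigcup_{\ell\in\mathbb{N}}\mathcal{L}_{\ell p+1}(\mathcal{A}_{\eta,s})\setminus\{0\,\mathtt{W}_{\min},1\,\mathtt{W}_{\max}\}\mathcal{D}^*$, and $f(0)=0$.
   Context: $A$ is a finite alphabet, $A^*$ the finite words, $\varepsilon$ the empty word, $|w|$ the length, $w[i]$ the $i$-th letter (from $0$). A substitution is a morphism $\eta:A^*\to A^*$ with $\eta(a)\neq\varepsilon$ for all $a$ and some letter growing ($|\eta^k(a)|\to\infty$). $\eta$ acts on $u\in A^{\mathbb{Z}}$ by $\eta(\cdots u_{-1}|u_0\cdots)=\cdots\eta(u_{-2})\eta(u_{-1})|\eta(u_0)\eta(u_1)\cdots$ ($|$ separating positions $-1$ and $0$); $u$ is a periodic point if $\eta^p(u)=u$ for some $p\ge1$, its period is the least such $p$; the seed $u_{-1}|u_0$ is growing if both letters are growing. A sequence $(m_i,a_i)_{i=0,\dots,k}$ in $A^*\times A$ is $x$-admissible if $m_{i-1}a_{i-1}$ is a prefix of $\eta(a_i)$ for $1\le i\le k$ and $m_ka_k$ is a prefix of $\eta(x)$. Let $\mathcal{D}=\{0,\dots,\max_c|\eta(c)|-1\}$;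 $\odot$ (or juxtaposition) is concatenation of words over $\mathcal{D}$. For $q\ge1$, $x\in A$, $0\le n<|\eta^q(x)|$ there is a unique $x$-admissible $(m_i,a_i)_{i=0,\dots,q-1}$ with $n=\sum_j|\eta^j(m_j)|$, and $\mathrm{tail}_{\eta,q,x}(n)=|m_{q-1}|\odot\cdots\odot|m_0|$. Set $\mathtt{W}_{\min}=0^p$, $\mathtt{W}_{\max}=\mathrm{tail}_{\eta,p,u_{-1}}(|\eta^p(u_{-1})|-1)$. Numeration system: for $n\ge1$ there are a unique $k$ divisible by $p$ and a unique $u_0$-admissible $(m_i,a_i)_{i=0,\dots,k-1}$ with $m_{k-1}\cdots m_{k-p}\ne\varepsilon$ and $u_0\cdots u_{n-1}=\eta^{k-1}(m_{k-1})\cdots\eta^0(m_0)$; for $n\le-2$ there are a unique $k$ divisible by $p$ and a unique $u_{-1}$-admissible $(m_i,a_i)_{i=0,\dots,k-1}$ with $\eta^{p-1}(m_{k-1})\cdots\eta^0(m_{k-p})a_{k-p}\ne\eta^p(u_{-1})$ and $u_{-|\eta^k(u_{-1})|}\cdots u_{n-1}=\eta^{k-1}(m_{k-1})\cdots\eta^0(m_0)$. Then $\mathrm{rep}_u(n)=0\odot|m_{k-1}|\odot\cdots\odot|m_0|$ ($n\ge1$), $\mathrm{rep}_u(0)=0$, $\mathrm{rep}_u(-1)=1$, $\mathrm{rep}_u(n)=1\odot|m_{k-1}|\odot\cdots\odot|m_0|$ ($n\le-2$). The automaton $\mathcal{A}_{\eta,s}$ has states $A\cup\{\mathtt{start}\}$,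 initial state $\mathtt{start}$, accepting states $A$, partial transitions $\delta(\mathtt{start},0)=u_0$, $\delta(\mathtt{start},1)=u_{-1}$, $\delta(c,i)=\eta(c)[i]$ for $c\in A$, $0\le i<|\eta(c)|$, extended to words; $\mathcal{L}_q(\mathcal{A}_{\eta,s})$ is the set of words $w\in\mathcal{D}^*$ of length $q$ with $\delta(\mathtt{start},w)$ defined and in $A$. Orders: $<_{lex}$ lexicographic on $\mathcal{D}^*$; $u<_{rad}v$ iff $|u|<|v|$ or ($|u|=|v|$ and $u<_{lex}v$); $u<_{rev}v$ iff $|u|>|v|$ or ($|u|=|v|$ and $u<_{lex}v$); for $u,v\in\{0,1\}\mathcal{D}^*$, $u\prec v$ iff ($u\in1\mathcal{D}^*$, $v\in0\mathcal{D}^*$) or ($u,v\in0\mathcal{D}^*$, $u<_{rad}v$) or ($u,v\in1\mathcal{D}^*$, $u<_{rev}v$). *)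

theory Defs
  imports Complex_Main "HOL-Library.Sublist"
begin

definition growing :: "('a list \<Rightarrow> 'a list) \<Rightarrow> 'a \<Rightarrow> bool" where
  "growing \<eta> a \<longleftrightarrow> filterlim (\<lambda>k. length ((\<eta> ^^ k) [a])) at_top sequentially"

definition substitution :: "('a list \<Rightarrow> 'a list) \<Rightarrow> bool" where
  "substitution \<eta> \<longleftrightarrow>
     (\<forall>v w. \<eta> (v @ w) = \<eta> v @ \<eta> w) \<and> (\<forall>a. \<eta> [a] \<noteq> []) \<and> (\<exists>a. growing \<eta> a)"

text \<open>Action on two-sided sequences. Since a substitution is non-erasing, the image of
  \<open>u\<^sub>0 \<dots> u\<^sub>i\<close> reaches position \<open>i\<close> when it is laid out to the right from position \<open>0\<close>, and
  the image of \<open>u\<^sub>i \<dots> u\<^sub>-\<^sub>1\<close> for \<open>i < 0\<close> reaches position \<open>i\<close> when it is laid out to end at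
  position \<open>-1\<close>.\<close>

definition act :: "('a list \<Rightarrow> 'a list) \<Rightarrow> (int \<Rightarrow> 'a) \<Rightarrow> (int \<Rightarrow> 'a)" where
  "act \<eta> u i =
     (if 0 \<le> i then \<eta> (map u [0..i]) ! nat i
      else let w = \<eta> (map u [i..-1]) in w ! nat (int (length w) + i))"

definition periodic_point :: "('a list \<Rightarrow> 'a list) \<Rightarrow> (int \<Rightarrow> 'a) \<Rightarrow> bool" where
  "periodic_point \<eta> u \<longleftrightarrow> (\<exists>p\<ge>1. (act \<eta> ^^ p) u = u)"

definition period :: "('a list \<Rightarrow> 'a list) \<Rightarrow> (int \<Rightarrow> 'a) \<Rightarrow> nat" where
  "period \<eta> u = (LEAST p. 1 \<le> p \<and> (act \<eta> ^^ p) u = u)"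

text \<open>A sequence \<open>(m\<^sub>i, a\<^sub>i)\<close>, \<open>i = 0, \<dots>, k\<close>, is a list of length \<open>k + 1\<close> whose entry at index
  \<open>i\<close> is \<open>(m\<^sub>i, a\<^sub>i)\<close>; in particular it is non-empty.\<close>

definition admissible :: "('a list \<Rightarrow> 'a list) \<Rightarrow> 'a \<Rightarrow> ('a list \<times> 'a) list \<Rightarrow> bool" where
  "admissible \<eta> x ms \<longleftrightarrow>
     ms \<noteq> [] \<and>
     (\<forall>i. 1 \<le> i \<and> i < length ms \<longrightarrow>
        prefix (fst (ms ! (i - 1)) @ [snd (ms ! (i - 1))]) (\<eta> [snd (ms ! i)])) \<and>
     prefix (fst (last ms) @ [snd (last ms)]) (\<eta> [x])"

definition digits :: "('a::finite list \<Rightarrow> 'a list) \<Rightarrow> nat set" where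
  "digits \<eta> = {0..<Max (range (\<lambda>c. length (\<eta> [c])))}"

text \<open>The word \<open>|m\<^sub>k\<^sub>-\<^sub>1| \<odot> \<dots> \<odot> |m\<^sub>0|\<close>.\<close>

definition digit_word :: "('a list \<times> 'a) list \<Rightarrow> nat list" where
  "digit_word ms = rev (map (\<lambda>(m, a). length m) ms)"

definition tail :: "('a list \<Rightarrow> 'a list) \<Rightarrow> nat \<Rightarrow> 'a \<Rightarrow> nat \<Rightarrow> nat list" where
  "tail \<eta> q x n =
     digit_word (THE ms. length ms = q \<and> admissible \<eta> x ms \<and>
       n = (\<Sum>j<q. length ((\<eta> ^^ j) (fst (ms ! j)))))"

definition W_min :: "('a list \<Rightarrow> 'a list) \<Rightarrow> (int \<Rightarrow> 'a) \<Rightarrow> nat list" where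
  "W_min \<eta> u = replicate (period \<eta> u) 0"

definition W_max :: "('a list \<Rightarrow> 'a list) \<Rightarrow> (int \<Rightarrow> 'a) \<Rightarrow> nat list" where
  "W_max \<eta> u =
     tail \<eta> (period \<eta> u) (u (-1)) (length ((\<eta> ^^ period \<eta> u) [u (-1)]) - 1)"

text \<open>The word \<open>\<eta>\<^sup>k\<^sup>-\<^sup>1(m\<^sub>k\<^sub>-\<^sub>1) \<dots> \<eta>\<^sup>0(m\<^sub>0)\<close>.\<close>

definition expansion :: "('a list \<Rightarrow> 'a list) \<Rightarrow> ('a list \<times> 'a) list \<Rightarrow> 'a list" where
  "expansion \<eta> ms = concat (map (\<lambda>i. (\<eta> ^^ i) (fst (ms ! i))) (rev [0..<length ms]))"

definition rep_seq_pos ::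
  "('a list \<Rightarrow> 'a list) \<Rightarrow> (int \<Rightarrow> 'a) \<Rightarrow> int \<Rightarrow> ('a list \<times> 'a) list \<Rightarrow> bool" where
  "rep_seq_pos \<eta> u n ms \<longleftrightarrow>
     (let p = period \<eta> u; k = length ms in
        p dvd k \<and> admissible \<eta> (u 0) ms \<and>
        concat (map (\<lambda>i. fst (ms ! i)) (rev [k - p..<k])) \<noteq> [] \<and>
        map u [0..n - 1] = expansion \<eta> ms)"

text \<open>The bound \<open>-|\<eta>\<^sup>k(u\<^sub>-\<^sub>1)| \<le> n\<close> says that the factor of \<open>u\<close> from position \<open>-|\<eta>\<^sup>k(u\<^sub>-\<^sub>1)|\<close>
  to position \<open>n - 1\<close> is meaningful (and empty only in the case of equality); without it,
  the interval list would collapse to the empty word for all smaller \<open>n\<close>.\<close>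

definition rep_seq_neg ::
  "('a list \<Rightarrow> 'a list) \<Rightarrow> (int \<Rightarrow> 'a) \<Rightarrow> int \<Rightarrow> ('a list \<times> 'a) list \<Rightarrow> bool" where
  "rep_seq_neg \<eta> u n ms \<longleftrightarrow>
     (let p = period \<eta> u; k = length ms; N = int (length ((\<eta> ^^ k) [u (-1)])) in
        p dvd k \<and> admissible \<eta> (u (-1)) ms \<and>
        expansion \<eta> (drop (k - p) ms) @ [snd (ms ! (k - p))] \<noteq> (\<eta> ^^ p) [u (-1)] \<and>
        - N \<le> n \<and> map u [- N..n - 1] = expansion \<eta> ms)"

definition rep :: "('a list \<Rightarrow> 'a list) \<Rightarrow> (int \<Rightarrow> 'a) \<Rightarrow> int \<Rightarrow> nat list" where
  "rep \<eta> u n =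
     (if 1 \<le> n then 0 # digit_word (THE ms. rep_seq_pos \<eta> u n ms)
      else if n = 0 then [0]
      else if n = -1 then [1]
      else 1 # digit_word (THE ms. rep_seq_neg \<eta> u n ms))"

datatype 'a state = Start | Letter 'a

text \<open>The seed \<open>u\<^sub>-\<^sub>1|u\<^sub>0\<close> is the pair \<open>(u\<^sub>-\<^sub>1, u\<^sub>0)\<close>.\<close>

fun delta :: "('a list \<Rightarrow> 'a list) \<Rightarrow> 'a \<times> 'a \<Rightarrow> 'a state \<Rightarrow> nat \<Rightarrow> 'a state option" where
  "delta \<eta> s Start d =
     (if d = 0 then Some (Letter (snd s)) else if d = 1 then Some (Letter (fst s)) else None)"
| "delta \<eta> s (Letter c) d =
     (if d < length (\<eta> [c]) then Some (Letter (\<eta> [c] ! d)) else None)"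

fun delta_word ::
  "('a list \<Rightarrow> 'a list) \<Rightarrow> 'a \<times> 'a \<Rightarrow> 'a state \<Rightarrow> nat list \<Rightarrow> 'a state option" where
  "delta_word \<eta> s q [] = Some q"
| "delta_word \<eta> s q (d # w) = Option.bind (delta \<eta> s q d) (\<lambda>q'. delta_word \<eta> s q' w)"

definition lang :: "('a::finite list \<Rightarrow> 'a list) \<Rightarrow> 'a \<times> 'a \<Rightarrow> nat \<Rightarrow> nat list set" where
  "lang \<eta> s q =
     {w \<in> lists (digits \<eta>). length w = q \<and> (\<exists>c. delta_word \<eta> s Start w = Some (Letter c))}"

definition words_from :: "nat list set \<Rightarrow> nat set \<Rightarrow> nat list set" where
  "words_from X D = {x @ v | x v. x \<in> X \<and> v \<in> lists D}"

definition less_lex :: "nat list \<Rightarrow> nat list \<Rightarrow> bool" where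
  "less_lex v w \<longleftrightarrow> (v, w) \<in> lexord less_than"

definition less_rad :: "nat list \<Rightarrow> nat list \<Rightarrow> bool" where
  "less_rad v w \<longleftrightarrow> length v < length w \<or> (length v = length w \<and> less_lex v w)"

definition less_rev :: "nat list \<Rightarrow> nat list \<Rightarrow> bool" where
  "less_rev v w \<longleftrightarrow> length v > length w \<or> (length v = length w \<and> less_lex v w)"

definition prec :: "nat set \<Rightarrow> nat list \<Rightarrow> nat list \<Rightarrow> bool" where
  "prec D v w \<longleftrightarrow>
     (v \<in> words_from {[1]} D \<and> w \<in> words_from {[0]} D) \<or>
     (v \<in> words_from {[0]} D \<and> w \<in> words_from {[0]} D \<and> less_rad v w) \<or>
     (v \<in> words_from {[1]} D \<and> w \<in> words_from {[1]} D \<and> less_rev v w)"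

end

theory Submission
  imports Defs
begin

text \<open>A digit word read from a letter \<open>x\<close> is a path in the automaton and addresses one position of
  \<open>\<eta>\<^sup>k(x)\<close>; for fixed length, lexicographic order is the order of positions. Attaching to
  \<open>0w\<close> the position of \<open>w\<close> in \<open>\<eta>\<^sup>k(u\<^sub>0)\<close>, and to \<open>1w\<close> that in \<open>\<eta>\<^sup>k(u\<^sub>-\<^sub>1)\<close> counted
  from the right end, gives a value map into the integers. Since \<open>\<eta>\<^sup>p(u\<^sub>0)\<close> begins with \<open>u\<^sub>0\<close> and
  \<open>\<eta>\<^sup>p(u\<^sub>-\<^sub>1)\<close> ends with \<open>u\<^sub>-\<^sub>1\<close>, forbidding the first block to be \<open>W\<^sub>min\<close> or \<open>W\<^sub>max\<close>
  places the words of each length outside the range covered by shorter ones. So the value map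
  is strictly increasing and injective on the language, and \<open>rep\<close> is its inverse. Any other increasing enumeration composes with it to an
  increasing surjection of the integers fixing \<open>0\<close>, which is the identity.\<close>

section \<open>Digit words as automaton paths and as admissible sequences\<close>

primrec valid :: "('a list \<Rightarrow> 'a list) \<Rightarrow> 'a \<Rightarrow> nat list \<Rightarrow> bool" where
  "valid \<eta> x [] \<longleftrightarrow> True"
| "valid \<eta> x (d # w) \<longleftrightarrow> d < length (\<eta> [x]) \<and> valid \<eta> (\<eta> [x] ! d) w"

primrec target :: "('a list \<Rightarrow> 'a list) \<Rightarrow> 'a \<Rightarrow> nat list \<Rightarrow> 'a" where
  "target \<eta> x [] = x"
| "target \<eta> x (d # w) = target \<eta> (\<eta> [x] ! d) w"

text \<open>The prefix of \<open>\<eta>\<^sup>k(x)\<close>, with \<open>k\<close> the length of the digit word, that precedes the letter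
  the word addresses; its length is the value of the word.\<close>

primrec pre :: "('a list \<Rightarrow> 'a list) \<Rightarrow> 'a \<Rightarrow> nat list \<Rightarrow> 'a list" where
  "pre \<eta> x [] = []"
| "pre \<eta> x (d # w) = (\<eta> ^^ length w) (take d (\<eta> [x])) @ pre \<eta> (\<eta> [x] ! d) w"

text \<open>Index 0 holds the least significant pair, as in the indexing of
  \<open>(m\<^sub>i, a\<^sub>i)\<close>, while a digit word starts with its most significant digit.
  Hence the head digit is appended at the end.\<close>

primrec seq :: "('a list \<Rightarrow> 'a list) \<Rightarrow> 'a \<Rightarrow> nat list \<Rightarrow> ('a list \<times> 'a) list" where
  "seq \<eta> x [] = []"
| "seq \<eta> x (d # w) = seq \<eta> (\<eta> [x] ! d) w @ [(take d (\<eta> [x]), \<eta> [x] ! d)]"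

lemma length_seq [simp]: "length (seq \<eta> x w) = length w"
  by (induction w arbitrary: x) auto

lemma digit_word_seq: "valid \<eta> x w \<Longrightarrow> digit_word (seq \<eta> x w) = w"
  by (induction w arbitrary: x) (auto simp: digit_word_def)

text \<open>A new last entry has the highest index, so it contributes the leading factor. This is
  why inductions over sequences run from the end.\<close>

lemma expansion_snoc:
  "expansion \<eta> (ms @ [y]) = (\<eta> ^^ length ms) (fst y) @ expansion \<eta> ms"
  by (auto simp: expansion_def nth_append intro!: arg_cong[where f = concat] map_cong)

lemma expansion_seq: "expansion \<eta> (seq \<eta> x w) = pre \<eta> x w"
  by (induction w arbitrary: x) (simp_all add: expansion_snoc, simp add: expansion_def)

lemma length_expansion:
  "length (expansion \<eta> ms) = (\<Sum>j<length ms. length ((\<eta> ^^ j) (fst (ms ! j))))"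
  by (induction ms rule: rev_induct)
    (simp_all add: expansion_snoc nth_append, simp add: expansion_def)

text \<open>Turns the index conditions into a recursion from the top entry, parallel to
  \<open>valid\<close> and \<open>seq\<close>. The empty remainder is a separate case because
  \<open>admissible\<close> excludes the empty list.\<close>

lemma admissible_snoc:
  "admissible \<eta> x (ms @ [y]) \<longleftrightarrow>
     prefix (fst y @ [snd y]) (\<eta> [x]) \<and> (ms = [] \<or> admissible \<eta> (snd y) ms)"
proof (cases ms rule: rev_cases)
  case Nil
  then show ?thesis by (simp add: admissible_def)
next
  case (snoc ns z)
  show ?thesis
  proof
    assume *: "admissible \<eta> x (ms @ [y])"
    have step: "prefix (fst ((ms @ [y]) ! (i - 1)) @ [snd ((ms @ [y]) ! (i - 1))])
        (\<eta> [snd ((ms @ [y]) ! i)])" if "1 \<le> i" "i < Suc (length ms)" for i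
      using * that unfolding admissible_def by auto
    have "prefix (fst (ms ! (i - 1)) @ [snd (ms ! (i - 1))]) (\<eta> [snd (ms ! i)])"
      if "1 \<le> i" "i < length ms" for i
    proof -
      have "i - 1 < length ms" using that by simp
      then show ?thesis using step[of i] that by (simp add: nth_append)
    qed
    \<comment> \<open>The index \<open>length ms\<close> is the junction between the old list and
      the new entry.\<close>
    moreover have "prefix (fst z @ [snd z]) (\<eta> [snd y])"
      using step[of "length ms"] snoc by (simp add: nth_append)
    ultimately show "prefix (fst y @ [snd y]) (\<eta> [x]) \<and> (ms = [] \<or> admissible \<eta> (snd y) ms)"
      using * snoc unfolding admissible_def by auto
  next
    assume *: "prefix (fst y @ [snd y]) (\<eta> [x]) \<and> (ms = [] \<or> admissible \<eta> (snd y) ms)"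
    then have adm: "admissible \<eta> (snd y) ms" using snoc by simp
    have "prefix (fst ((ms @ [y]) ! (i - 1)) @ [snd ((ms @ [y]) ! (i - 1))])
        (\<eta> [snd ((ms @ [y]) ! i)])" if "1 \<le> i" "i < Suc (length ms)" for i
    proof (cases "i = length ms")
      case True
      then show ?thesis using adm snoc unfolding admissible_def by (simp add: nth_append)
    next
      case False
      then show ?thesis using adm that unfolding admissible_def by (auto simp: nth_append)
    qed
    then show "admissible \<eta> x (ms @ [y])" using * unfolding admissible_def by auto
  qed
qed

text \<open>Given the image word, a pair of an admissible sequence is determined by the length of
  its first component, so digits lose no information.\<close>

lemma prefix_snoc_iff_take_nth:
  "prefix (m @ [a]) w \<longleftrightarrow>
     length m < length w \<and> m = take (length m) w \<and> a = w ! length m"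
proof
  assume "prefix (m @ [a]) w"
  then show "length m < length w \<and> m = take (length m) w \<and> a = w ! length m"
    by (auto simp: prefix_def)
next
  assume *: "length m < length w \<and> m = take (length m) w \<and> a = w ! length m"
  then have "m @ [a] = take (Suc (length m)) w"
    by (metis take_Suc_conv_app_nth)
  then show "prefix (m @ [a]) w" by (metis take_is_prefix)
qed

lemma admissible_seq: "valid \<eta> x w \<Longrightarrow> w \<noteq> [] \<Longrightarrow> admissible \<eta> x (seq \<eta> x w)"
proof (induction w arbitrary: x)
  case (Cons d w)
  then show ?case
    by (cases "w = []")
      (auto simp: admissible_snoc[of \<eta> x "[]", simplified] admissible_snoc prefix_snoc_iff_take_nth)
qed simp

text \<open>With \<open>admissible_seq\<close> and \<open>digit_word_seq\<close>, this makes
  \<open>seq\<close> and \<open>digit_word\<close> inverse bijections between nonempty valid words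
  and admissible sequences. Every unique description of a sequence can then be treated as one of a
  word.\<close>

lemma admissible_imp_seq:
  "admissible \<eta> x ms \<Longrightarrow> valid \<eta> x (digit_word ms) \<and> seq \<eta> x (digit_word ms) = ms"
proof (induction ms arbitrary: x rule: rev_induct)
  case Nil
  then show ?case by (simp add: admissible_def)
next
  case (snoc y ms)
  have p: "prefix (fst y @ [snd y]) (\<eta> [x])" and q: "ms = [] \<or> admissible \<eta> (snd y) ms"
    using snoc.prems by (auto simp: admissible_snoc)
  have y: "length (fst y) < length (\<eta> [x])" "take (length (fst y)) (\<eta> [x]) = fst y"
    "\<eta> [x] ! length (fst y) = snd y"
    using p by (auto simp: prefix_snoc_iff_take_nth)
  have dw: "digit_word (ms @ [y]) = length (fst y) # digit_word ms"
    by (simp add: digit_word_def split_beta)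
  show ?case
  proof (cases "ms = []")
    case True
    then show ?thesis using y by (simp add: digit_word_def split_beta)
  next
    case False
    then show ?thesis using q snoc.IH[of "snd y"] y dw by simp
  qed
qed

lemma valid_append: "valid \<eta> x (v @ w) \<longleftrightarrow> valid \<eta> x v \<and> valid \<eta> (target \<eta> x v) w"
  by (induction v arbitrary: x) auto

lemma seq_append: "seq \<eta> x (v @ w) = seq \<eta> (target \<eta> x v) w @ seq \<eta> x v"
  by (induction v arbitrary: x) auto

lemma snd_hd_seq: "v \<noteq> [] \<Longrightarrow> snd (seq \<eta> x v ! 0) = target \<eta> x v"
proof (induction v arbitrary: x)
  case (Cons d v)
  then show ?case by (cases "v = []") (auto simp: nth_append)
qed simp

text \<open>Translates the condition on
  \<open>m\<^sub>k\<^sub>-\<^sub>1 \<dots> m\<^sub>k\<^sub>-\<^sub>p\<close> into the exclusion of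
  the block of zeros: validity makes each image nonempty, so \<open>take d\<close> is empty only for
  digit 0.\<close>

lemma concat_fst_seq_eq_Nil:
  "valid \<eta> x v \<Longrightarrow> concat (map fst (rev (seq \<eta> x v))) = [] \<longleftrightarrow> v = replicate (length v) 0"
proof (induction v arbitrary: x)
  case (Cons d v)
  then have "\<eta> [x] \<noteq> []" by auto
  with Cons show ?case by auto
qed simp

section \<open>Automaton runs, forbidden prefixes and integer intervals\<close>

lemma delta_word_Letter:
  "delta_word \<eta> s (Letter x) w = (if valid \<eta> x w then Some (Letter (target \<eta> x w)) else None)"
  by (induction w arbitrary: x) auto

lemma valid_imp_digits:
  fixes \<eta> :: "'a::finite list \<Rightarrow> 'a list"
  shows "valid \<eta> x w \<Longrightarrow> w \<in> lists (digits \<eta>)"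
proof (induction w arbitrary: x)
  case (Cons d w)
  have "length (\<eta> [x]) \<le> Max (range (\<lambda>c. length (\<eta> [c])))" by (rule Max_ge) auto
  moreover have "d < length (\<eta> [x])" "w \<in> lists (digits \<eta>)" using Cons by auto
  ultimately show ?case unfolding digits_def by (simp add: less_le_trans)
qed simp

lemma mem_words_from_iff:
  assumes "w \<in> lists D"
  shows "w \<in> words_from X D \<longleftrightarrow> (\<exists>x\<in>X. prefix x w)"
proof
  assume "w \<in> words_from X D"
  then obtain x v where "w = x @ v" "x \<in> X" unfolding words_from_def by blast
  then show "\<exists>x\<in>X. prefix x w" by (metis prefixI)
next
  assume "\<exists>x\<in>X. prefix x w"
  then obtain x v where x: "w = x @ v" "x \<in> X" by (auto simp: prefix_def)
  then have "v \<in> lists D" using assms by simp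
  with x show "w \<in> words_from X D" unfolding words_from_def by blast
qed

lemma less_lex_linear: "less_lex v w \<or> v = w \<or> less_lex w v"
  unfolding less_lex_def by (rule lexord_linear) auto

lemma upto_split: "i \<le> j \<Longrightarrow> j \<le> k \<Longrightarrow> [i..k - 1] = [i..j - 1] @ [j..k - (1::int)]"
proof -
  assume "i \<le> j" "j \<le> k"
  then show ?thesis
    using upto_split1[of i j "k - 1"] by (cases "j = k") auto
qed

lemma concat_map_rev_upt:
  "concat (map (\<lambda>i. fst (ms ! i)) (rev [k..<length ms])) = concat (map fst (rev (drop k ms)))"
proof -
  have "map (\<lambda>i. fst (ms ! i)) (rev [k..<length ms]) = rev (map fst (map ((!) ms) [k..<length ms]))"
    by (simp add: rev_map comp_def)
  also have "map ((!) ms) [k..<length ms] = drop k ms"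
    by (rule nth_equalityI) auto
  finally show ?thesis by (simp add: rev_map)
qed

lemma hd_words_from: "d # w \<in> words_from {[e]} D \<Longrightarrow> d = e"
  by (auto simp: words_from_def)

section \<open>Positions in iterated images of a letter\<close>

locale nonerasing =
  fixes \<eta> :: "'a list \<Rightarrow> 'a list"
  assumes append: "\<eta> (v @ w) = \<eta> v @ \<eta> w" and nonempty: "\<eta> [a] \<noteq> []"
begin

lemma image_Nil [simp]: "\<eta> [] = []"
  using append[of "[]" "[]"] by simp

lemma funpow_append: "(\<eta> ^^ k) (v @ w) = (\<eta> ^^ k) v @ (\<eta> ^^ k) w"
  by (induction k) (auto simp: append)

lemma funpow_Nil [simp]: "(\<eta> ^^ k) [] = []"
  by (induction k) auto

lemma length_le: "length w \<le> length (\<eta> w)"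
proof (induction w)
  case (Cons a w)
  have "length (\<eta> [a]) \<ge> 1" using nonempty[of a] by (cases "\<eta> [a]") auto
  with Cons show ?case using append[of "[a]" w] by simp
qed simp

lemma length_funpow_mono: "i \<le> j \<Longrightarrow> length ((\<eta> ^^ i) w) \<le> length ((\<eta> ^^ j) w)"
  by (rule lift_Suc_mono_le[where f = "\<lambda>k. length ((\<eta> ^^ k) w)"]) (auto intro: length_le)

lemma length_le_funpow: "length w \<le> length ((\<eta> ^^ k) w)"
  using length_funpow_mono[of 0 k w] by simp

text \<open>Reading \<open>length w\<close> further digits inflates everything left of the letter
  addressed by \<open>v\<close> by that power of \<open>\<eta>\<close>; the rest is an address
  inside the image of that letter.\<close>

lemma pre_append:
  "pre \<eta> x (v @ w) = (\<eta> ^^ length w) (pre \<eta> x v) @ pre \<eta> (target \<eta> x v) w"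
proof (induction v arbitrary: x)
  case (Cons d v)
  have "(\<eta> ^^ (length v + length w)) y = (\<eta> ^^ length w) ((\<eta> ^^ length v) y)" for y
    by (simp add: funpow_add add.commute[of "length v"])
  with Cons show ?case by (simp add: funpow_append)
qed simp

text \<open>A nonzero digit would contribute a nonempty factor, and iterated images never get
  shorter.\<close>

lemma pre_eq_Nil_imp_zeros:
  "valid \<eta> x w \<Longrightarrow> pre \<eta> x w = [] \<Longrightarrow> w = replicate (length w) 0"
proof (induction w arbitrary: x)
  case (Cons d w)
  have "length (take d (\<eta> [x])) = 0"
    using Cons.prems length_le_funpow[of "take d (\<eta> [x])" "length w"] by simp
  moreover have "length (\<eta> [x]) > 0" using nonempty by simp
  ultimately have "d = 0" by (simp add: min_def split: if_splits)
  with Cons show ?case by auto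
qed simp

lemma pre_zeros: "pre \<eta> x (replicate k 0) = []"
  by (induction k arbitrary: x) auto

lemma length_ge_1: "1 \<le> length ((\<eta> ^^ k) [x])"
  using length_le_funpow[of "[x]" k] by simp

lemma funpow_split:
  assumes "d < length (\<eta> [x])"
  shows "(\<eta> ^^ Suc k) [x] = (\<eta> ^^ k) (take d (\<eta> [x])) @ (\<eta> ^^ k) [\<eta> [x] ! d]
    @ (\<eta> ^^ k) (drop (Suc d) (\<eta> [x]))"
proof -
  have "(\<eta> ^^ Suc k) [x] = (\<eta> ^^ k) (\<eta> [x])" by (simp add: funpow_swap1)
  also have "\<eta> [x] = take d (\<eta> [x]) @ [\<eta> [x] ! d] @ drop (Suc d) (\<eta> [x])"
    using id_take_nth_drop[OF assms] by simp
  finally show ?thesis by (simp only: funpow_append)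
qed

lemma prefix_pre_target:
  "valid \<eta> x w \<Longrightarrow> prefix (pre \<eta> x w @ [target \<eta> x w]) ((\<eta> ^^ length w) [x])"
proof (induction w arbitrary: x)
  case (Cons d w)
  then show ?case
    using funpow_split[of d x "length w"] by (simp add: prefix_prefix)
qed simp

lemma length_pre_less: "valid \<eta> x w \<Longrightarrow> length (pre \<eta> x w) < length ((\<eta> ^^ length w) [x])"
  using prefix_length_le[OF prefix_pre_target] by fastforce

text \<open>At the first difference \<open>d < e\<close>, the address of \<open>v\<close> stays
  inside the image of the letter at index \<open>d\<close>, and \<open>w\<close> has skipped that
  whole image.\<close>

lemma length_pre_strict_mono:
  assumes "valid \<eta> x v" "valid \<eta> x w" "length v = length w" "less_lex v w"
  shows "length (pre \<eta> x v) < length (pre \<eta> x w)"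
  using assms
proof (induction v arbitrary: x w)
  case Nil
  then show ?case by (simp add: less_lex_def)
next
  case (Cons d v)
  then obtain e w' where w: "w = e # w'" by (cases w) auto
  show ?case
  proof (cases "d = e")
    case True
    with Cons w show ?thesis by (auto simp: less_lex_def)
  next
    case False
    then have de: "d < e" using Cons.prems w by (auto simp: less_lex_def)
    have len: "length v = length w'" using Cons.prems w by simp
    let ?k = "length v"
    have "length (pre \<eta> (\<eta> [x] ! d) v) < length ((\<eta> ^^ ?k) [\<eta> [x] ! d])"
      using Cons.prems by (intro length_pre_less) auto
    moreover have "(\<eta> ^^ ?k) (take (Suc d) (\<eta> [x])) =
        (\<eta> ^^ ?k) (take d (\<eta> [x])) @ (\<eta> ^^ ?k) [\<eta> [x] ! d]"
      using Cons.prems by (simp add: take_Suc_conv_app_nth funpow_append)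
    moreover have "take e (\<eta> [x]) = take (Suc d) (\<eta> [x]) @ take (e - Suc d) (drop (Suc d) (\<eta> [x]))"
      using de by (metis Suc_leI le_add_diff_inverse take_add)
    ultimately show ?thesis
      using w len by (simp add: funpow_append)
  qed
qed

lemma pre_inj:
  assumes "valid \<eta> x v" "valid \<eta> x w" "length v = length w"
    and "length (pre \<eta> x v) = length (pre \<eta> x w)"
  shows "v = w"
  using less_lex_linear[of v w] length_pre_strict_mono[of x v w]
    length_pre_strict_mono[of x w v] assms by auto

text \<open>The images of the single letters tile the image of \<open>w\<close>, and position
  \<open>n\<close> falls into one tile; its index is the greedy choice of the next digit.\<close>

lemma ex_digit:
  assumes "n < length ((\<eta> ^^ k) w)"
  shows "\<exists>d<length w. length ((\<eta> ^^ k) (take d w)) \<le> n \<and>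
    n < length ((\<eta> ^^ k) (take d w)) + length ((\<eta> ^^ k) [w ! d])"
  using assms
proof (induction w rule: rev_induct)
  case (snoc a w)
  show ?case
  proof (cases "n < length ((\<eta> ^^ k) w)")
    case True
    then obtain d where "d < length w" "length ((\<eta> ^^ k) (take d w)) \<le> n"
      "n < length ((\<eta> ^^ k) (take d w)) + length ((\<eta> ^^ k) [w ! d])"
      using snoc.IH by blast
    then show ?thesis by (intro exI[of _ d]) (auto simp: nth_append)
  next
    case False
    with snoc.prems show ?thesis
      by (intro exI[of _ "length w"]) (auto simp: funpow_append)
  qed
qed simp

text \<open>Greedy expansion: choose the tile containing \<open>n\<close>, then recurse with the
  offset inside it. Together with \<open>pre_inj\<close>, words of length \<open>k\<close>
  correspond exactly to positions.\<close>

lemma ex_valid: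
  "n < length ((\<eta> ^^ k) [x]) \<Longrightarrow> \<exists>w. valid \<eta> x w \<and> length w = k \<and> length (pre \<eta> x w) = n"
proof (induction k arbitrary: x n)
  case (Suc k)
  have "n < length ((\<eta> ^^ k) (\<eta> [x]))" using Suc.prems by (simp add: funpow_swap1)
  from ex_digit[OF this] obtain d where d: "d < length (\<eta> [x])"
    "length ((\<eta> ^^ k) (take d (\<eta> [x]))) \<le> n"
    "n < length ((\<eta> ^^ k) (take d (\<eta> [x]))) + length ((\<eta> ^^ k) [\<eta> [x] ! d])" by blast
  have "n - length ((\<eta> ^^ k) (take d (\<eta> [x]))) < length ((\<eta> ^^ k) [\<eta> [x] ! d])"
    using d by linarith
  from Suc.IH[OF this] obtain w where "valid \<eta> (\<eta> [x] ! d) w" "length w = k"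
    "length (pre \<eta> (\<eta> [x] ! d) w) = n - length ((\<eta> ^^ k) (take d (\<eta> [x])))" by blast
  with d show ?case by (intro exI[of _ "d # w"]) auto
qed simp

text \<open>Evaluates the definite description in \<open>tail\<close>. Uniqueness comes from
  \<open>pre_inj\<close>; \<open>q\<close> is positive since admissible sequences are
  nonempty.\<close>

lemma tail_eqI:
  assumes "valid \<eta> x w" "length w = q" "q \<noteq> 0" "length (pre \<eta> x w) = n"
  shows "tail \<eta> q x n = w"
proof -
  have "(THE ms. length ms = q \<and> admissible \<eta> x ms \<and>
       n = (\<Sum>j<q. length ((\<eta> ^^ j) (fst (ms ! j))))) = seq \<eta> x w"
  proof (rule the_equality)
    show "length (seq \<eta> x w) = q \<and> admissible \<eta> x (seq \<eta> x w) \<and>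
       n = (\<Sum>j<q. length ((\<eta> ^^ j) (fst (seq \<eta> x w ! j))))"
      using assms admissible_seq[of \<eta> x w] length_expansion[of \<eta> "seq \<eta> x w"]
      by (auto simp: expansion_seq)
  next
    fix ms assume ms: "length ms = q \<and> admissible \<eta> x ms \<and>
       n = (\<Sum>j<q. length ((\<eta> ^^ j) (fst (ms ! j))))"
    then have v: "valid \<eta> x (digit_word ms)" "seq \<eta> x (digit_word ms) = ms"
      using admissible_imp_seq[of \<eta> x ms] by auto
    have "length (pre \<eta> x (digit_word ms)) = n"
      using ms v expansion_seq[of \<eta> x "digit_word ms"] length_expansion[of \<eta> ms] by simp
    moreover have "length (digit_word ms) = q" using ms by (simp add: digit_word_def)
    ultimately have "digit_word ms = w" using pre_inj v assms by metis
    then show "ms = seq \<eta> x w" using v by simp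
  qed
  then show ?thesis using assms by (simp add: tail_def digit_word_seq)
qed

section \<open>The action on two-sided sequences\<close>

text \<open>\<open>act\<close> computes each position from its own finite factor. Of two factors
  starting at 0 one is a prefix of the other, so their images agree wherever both are
  defined.\<close>

lemma act_right:
  "map (act \<eta> u) [0..int (length (\<eta> (map u [0..int n - 1]))) - 1] = \<eta> (map u [0..int n - 1])"
  (is "map _ [0..int (length ?w) - 1] = _")
proof (rule nth_equalityI)
  fix i assume "i < length (map (act \<eta> u) [0..int (length ?w) - 1])"
  then have i: "i < length ?w" by simp
  let ?v = "map u [0..int i]"
  \<comment> \<open>Since no letter is erased, the image of \<open>i + 1\<close> letters reaches
    index \<open>i\<close>.\<close>
  have "Suc i = length ?v" by simp
  also have "\<dots> \<le> length (\<eta> ?v)" by (rule length_le)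
  finally have iv: "i < length (\<eta> ?v)" by simp
  have "\<eta> ?v ! i = ?w ! i"
  proof (cases "Suc i \<le> n")
    case True
    then have "map u [0..int n - 1] = ?v @ map u [int i + 1..int n - 1]"
      using upto_split[of 0 "int i + 1" "int n"] by simp
    then show ?thesis using iv by (simp add: append nth_append)
  next
    case False
    then have "?v = map u [0..int n - 1] @ map u [int n..int i]"
      using upto_split[of 0 "int n" "int i + 1"] by simp
    then show ?thesis using i by (simp add: append nth_append)
  qed
  then show "map (act \<eta> u) [0..int (length ?w) - 1] ! i = ?w ! i"
    using i by (simp add: act_def)
qed simp

text \<open>Mirror image of \<open>act_right\<close>: the factors now end at -1, one is a suffix of
  the other, and indices shift by the difference of the image lengths.\<close>

lemma act_left:
  "map (act \<eta> u) [- int (length (\<eta> (map u [- int n..-1])))..-1] = \<eta> (map u [- int n..-1])"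
  (is "map _ [- int (length ?w)..-1] = _")
proof (rule nth_equalityI)
  fix i assume "i < length (map (act \<eta> u) [- int (length ?w)..-1])"
  then have i: "i < length ?w" by simp
  define j where "j = - int (length ?w) + int i"
  have j: "j < 0" using i by (simp add: j_def)
  have i_eq: "int i = j + int (length ?w)" by (simp add: j_def)
  let ?v = "\<eta> (map u [j..-1])"
  have "nat (- j) = length (map u [j..-1])" by simp
  also have "\<dots> \<le> length ?v" by (rule length_le)
  finally have jv: "- j \<le> int (length ?v)" by linarith
  have "?v ! nat (int (length ?v) + j) = ?w ! i"
  proof (cases "- int n \<le> j")
    case True
    then have "map u [- int n..-1] = map u [- int n..j - 1] @ map u [j..-1]"
      using upto_split[of "- int n" j 0] j by simp
    then have w: "?w = \<eta> (map u [- int n..j - 1]) @ ?v" by (simp add: append)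
    have "length ?w = length (\<eta> (map u [- int n..j - 1])) + length ?v"
      using arg_cong[OF w, of length] by simp
    then have "nat (int (length ?v) + j) = i - length (\<eta> (map u [- int n..j - 1]))"
      "i \<ge> length (\<eta> (map u [- int n..j - 1]))"
      using jv i_eq by linarith+
    then show ?thesis using w by (simp add: nth_append)
  next
    case False
    then have "map u [j..-1] = map u [j..- int n - 1] @ map u [- int n..-1]"
      using upto_split[of j "- int n" 0] j by simp
    then have v: "?v = \<eta> (map u [j..- int n - 1]) @ ?w" by (simp add: append)
    have "nat (int (length ?v) + j) = length (\<eta> (map u [j..- int n - 1])) + i"
      using arg_cong[OF v, of length] i_eq by simp
    then show ?thesis using v by (simp add: nth_append)
  qed
  then show "map (act \<eta> u) [- int (length ?w)..-1] ! i = ?w ! i"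
    using i j by (simp add: act_def Let_def j_def)
qed simp

lemma act_funpow_right:
  "map ((act \<eta> ^^ k) u) [0..int (length ((\<eta> ^^ k) [u 0])) - 1] = (\<eta> ^^ k) [u 0]"
proof (induction k)
  case (Suc k)
  then show ?case
    using act_right[of "(act \<eta> ^^ k) u" "length ((\<eta> ^^ k) [u 0])"] by simp
qed simp

lemma act_funpow_left:
  "map ((act \<eta> ^^ k) u) [- int (length ((\<eta> ^^ k) [u (-1)]))..-1] = (\<eta> ^^ k) [u (-1)]"
proof (induction k)
  case (Suc k)
  then show ?case
    using act_left[of "(act \<eta> ^^ k) u" "length ((\<eta> ^^ k) [u (-1)])"] by simp
qed simp

end

section \<open>Consequences of growth\<close>

text \<open>If all images had length at most 1, no iterate could get longer. The long image puts the
  digit 1 into the digit alphabet.\<close>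

lemma (in nonerasing) growing_imp_long_image:
  assumes "growing \<eta> x"
  shows "\<exists>c. 1 < length (\<eta> [c])"
proof (rule ccontr)
  assume "\<not> ?thesis"
  then have short: "length (\<eta> [c]) \<le> 1" for c by (meson not_less)
  have "length (\<eta> w) \<le> length w" for w
  proof (induction w)
    case (Cons a w)
    with short[of a] show ?case using append[of "[a]" w] by simp
  qed simp
  then have "length ((\<eta> ^^ k) [x]) \<le> 1" for k
    by (induction k) (auto intro: order_trans)
  moreover have "\<exists>k. 2 \<le> length ((\<eta> ^^ k) [x])"
    using assms unfolding growing_def filterlim_at_top eventually_sequentially by blast
  ultimately show False by (metis not_less_eq_eq numeral_2_eq_2 One_nat_def)
qed

lemma (in nonerasing) growing_imp_unbounded:
  assumes "growing \<eta> x" "0 < p"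
  shows "\<exists>l. n < length ((\<eta> ^^ (l * p)) [x])"
proof -
  obtain k where k: "\<forall>j\<ge>k. Suc n \<le> length ((\<eta> ^^ j) [x])"
    using assms unfolding growing_def filterlim_at_top eventually_sequentially by blast
  \<comment> \<open>Multiples of \<open>p\<close> are cofinal, so the threshold \<open>k\<close>
    itself serves as the multiplier.\<close>
  have "k \<le> k * p" using assms(2) by simp
  with k show ?thesis by (intro exI[of _ k]) (auto simp: Suc_le_eq)
qed

section \<open>The periodic seed and the language of representations\<close>

locale periodic_seed = nonerasing \<eta> for \<eta> :: "'a::finite list \<Rightarrow> 'a list" +
  fixes u :: "int \<Rightarrow> 'a" and p :: nat
  assumes period_pos: "0 < p" and period_eq: "p = period \<eta> u"
    and fixed: "(act \<eta> ^^ p) u = u"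
    and growing_left: "growing \<eta> (u (-1))" and growing_right: "growing \<eta> (u 0)"
begin

abbreviation left_length :: "nat \<Rightarrow> nat" where
  "left_length k \<equiv> length ((\<eta> ^^ k) [u (-1)])"

abbreviation right_length :: "nat \<Rightarrow> nat" where
  "right_length k \<equiv> length ((\<eta> ^^ k) [u 0])"

lemma act_fixed: "p dvd k \<Longrightarrow> (act \<eta> ^^ k) u = u"
proof -
  have "(act \<eta> ^^ (l * p)) u = u" for l
    by (induction l) (simp_all add: funpow_add fixed)
  then show "p dvd k \<Longrightarrow> ?thesis" by (metis dvd_def mult.commute)
qed

lemma right_fixed: "p dvd k \<Longrightarrow> map u [0..int (right_length k) - 1] = (\<eta> ^^ k) [u 0]"
  using act_funpow_right[of k u] act_fixed[of k] by simp

lemma left_fixed: "p dvd k \<Longrightarrow> map u [- int (left_length k)..-1] = (\<eta> ^^ k) [u (-1)]"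
  using act_funpow_left[of k u] act_fixed[of k] by simp

text \<open>The word \<open>(\<eta> ^^ p) [u 0]\<close> is the factor of \<open>u\<close> beginning
  at position 0. Dually, in \<open>left_ends\<close> the factor ends at position -1.\<close>

lemma right_starts: "\<exists>r. (\<eta> ^^ p) [u 0] = u 0 # r"
proof -
  have "[0..int (right_length p) - 1] = 0 # [0 + 1..int (right_length p) - 1]"
    using length_ge_1[of p "u 0"] by (intro upto_rec1) auto
  then have "map u [0..int (right_length p) - 1] = u 0 # map u [0 + 1..int (right_length p) - 1]"
    by (simp only: list.map)
  then show ?thesis unfolding right_fixed[OF dvd_refl] by blast
qed

lemma left_ends: "\<exists>r. (\<eta> ^^ p) [u (-1)] = r @ [u (-1)]"
proof -
  have "[- int (left_length p)..-1] = [- int (left_length p)..-1 - 1] @ [-1]"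
    using length_ge_1[of p "u (-1)"] by (intro upto_rec2) auto
  then have "map u [- int (left_length p)..-1] = map u [- int (left_length p)..-1 - 1] @ [u (-1)]"
    by (simp only: map_append list.map)
  then show ?thesis unfolding left_fixed[OF dvd_refl] by blast
qed

text \<open>The sign digits must belong to the alphabet, because \<open>lang\<close> only admits
  words over \<open>digits \<eta>\<close>.\<close>

lemma digits_01: "0 \<in> digits \<eta>" "1 \<in> digits \<eta>"
proof -
  obtain c where "1 < length (\<eta> [c])" using growing_imp_long_image[OF growing_left] by blast
  also have "\<dots> \<le> Max (range (\<lambda>c. length (\<eta> [c])))" by (rule Max_ge) auto
  finally show "0 \<in> digits \<eta>" "1 \<in> digits \<eta>" unfolding digits_def by simp_all
qed

definition rep_lang :: "nat list set" where
  "rep_lang = (\<Union>l::nat. lang \<eta> (u (-1), u 0) (l * p + 1))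
        - words_from {0 # W_min \<eta> u, 1 # W_max \<eta> u} (digits \<eta>)"

definition right_word :: "nat list \<Rightarrow> bool" where
  "right_word w \<longleftrightarrow> valid \<eta> (u 0) w \<and> p dvd length w \<and> \<not> prefix (replicate p 0) w"

definition left_word :: "nat list \<Rightarrow> bool" where
  "left_word w \<longleftrightarrow> valid \<eta> (u (-1)) w \<and> p dvd length w \<and> \<not> prefix (W_max \<eta> u) w"

lemma mem_lang_union_iff:
  "d # w \<in> (\<Union>l::nat. lang \<eta> (u (-1), u 0) (l * p + 1)) \<longleftrightarrow>
     p dvd length w \<and> (d = 0 \<and> valid \<eta> (u 0) w \<or> d = 1 \<and> valid \<eta> (u (-1)) w)"
proof -
  have "(\<exists>l. length w = l * p) \<longleftrightarrow> p dvd length w" by (simp add: dvd_def mult.commute)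
  then show ?thesis
    using digits_01 valid_imp_digits[of \<eta> "u 0" w] valid_imp_digits[of \<eta> "u (-1)" w]
    by (simp add: lang_def delta_word_Letter)
qed

text \<open>The sign digit decides both the starting letter and which of the two forbidden prefixes
  can occur.\<close>

lemma mem_rep_lang_iff:
  "d # w \<in> rep_lang \<longleftrightarrow> d = 0 \<and> right_word w \<or> d = 1 \<and> left_word w"
proof (cases "(d = 0 \<or> d = 1) \<and> w \<in> lists (digits \<eta>)")
  case True
  then have "d # w \<in> lists (digits \<eta>)" using digits_01 by auto
  then have *: "d # w \<in> words_from {0 # W_min \<eta> u, 1 # W_max \<eta> u} (digits \<eta>) \<longleftrightarrow>
      d = 0 \<and> prefix (replicate p 0) w \<or> d = 1 \<and> prefix (W_max \<eta> u) w"
    by (auto simp: mem_words_from_iff W_min_def period_eq[symmetric])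
  have "d = 0 \<or> d = 1" using True by blast
  then show ?thesis
    unfolding rep_lang_def Diff_iff mem_lang_union_iff * right_word_def left_word_def
    by (elim disjE) (simp_all add: conj_ac)
next
  case False
  then show ?thesis
    unfolding rep_lang_def Diff_iff mem_lang_union_iff right_word_def left_word_def
    using valid_imp_digits[of \<eta> "u 0" w] valid_imp_digits[of \<eta> "u (-1)" w] by argo
qed

lemma rep_lang_cases:
  assumes "s \<in> rep_lang"
  obtains w where "s = 0 # w" "right_word w" | w where "s = 1 # w" "left_word w"
proof (cases s)
  case Nil
  with assms show ?thesis by (auto simp: rep_lang_def lang_def)
next
  case (Cons d w)
  then have "d = 0 \<and> right_word w \<or> d = 1 \<and> left_word w"
    using assms by (simp only: mem_rep_lang_iff)
  then show ?thesis using that[of w] Cons by blast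
qed

section \<open>The leading block of length p\<close>

lemma split_block:
  assumes "p dvd length w" "w \<noteq> []"
  obtains v w' where "w = v @ w'" "length v = p" "p dvd length w'"
proof -
  have "p \<le> length w" using assms by (simp add: dvd_imp_le)
  then show ?thesis
    using assms that[of "take p w" "drop p w"] by (simp add: dvd_minus_self)
qed

text \<open>If nothing precedes the letter addressed by \<open>v\<close>, that letter is the initial
  \<open>u 0\<close> of \<open>(\<eta> ^^ p) [u 0]\<close>, and the position stays within the image
  of \<open>u 0\<close> under \<open>\<eta> ^^ length w\<close>. Otherwise the skipped prefix begins
  with \<open>u 0\<close>, so that whole image is passed.\<close>

lemma right_pre_block:
  assumes "valid \<eta> (u 0) (v @ w)" "length v = p"
  shows "v \<noteq> replicate p 0 \<longleftrightarrow> right_length (length w) \<le> length (pre \<eta> (u 0) (v @ w))"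
proof -
  have vv: "valid \<eta> (u 0) v" "valid \<eta> (target \<eta> (u 0) v) w"
    using assms by (auto simp: valid_append)
  have pr: "prefix (pre \<eta> (u 0) v @ [target \<eta> (u 0) v]) ((\<eta> ^^ p) [u 0])"
    using prefix_pre_target[OF vv(1)] assms by simp
  obtain r where r: "(\<eta> ^^ p) [u 0] = u 0 # r" using right_starts by blast
  show ?thesis
  proof (cases "pre \<eta> (u 0) v")
    case Nil
    then have "target \<eta> (u 0) v = u 0" using pr r by simp
    then have "length (pre \<eta> (u 0) (v @ w)) < right_length (length w)"
      using Nil length_pre_less[OF vv(2)] by (simp add: pre_append)
    moreover have "v = replicate p 0" using pre_eq_Nil_imp_zeros[OF vv(1) Nil] assms by simp
    ultimately show ?thesis by simp
  next
    case (Cons y ys)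
    then have "pre \<eta> (u 0) v = [u 0] @ ys" using pr r by simp
    then have "right_length (length w) \<le> length (pre \<eta> (u 0) (v @ w))"
      by (simp only: pre_append funpow_append length_append)
    moreover have "v \<noteq> replicate p 0" using Cons pre_zeros by force
    ultimately show ?thesis by simp
  qed
qed

text \<open>Seen from the right end: if no letter follows the one addressed by \<open>v\<close>, it
  is the final \<open>u (-1)\<close>, and the position lies in the last copy of the image of
  \<open>u (-1)\<close>. Otherwise the remaining letters end with \<open>u (-1)\<close>, and that
  copy lies entirely to the right of the position.\<close>

lemma left_pre_block:
  assumes "valid \<eta> (u (-1)) (v @ w)" "length v = p"
  shows "pre \<eta> (u (-1)) v @ [target \<eta> (u (-1)) v] \<noteq> (\<eta> ^^ p) [u (-1)] \<longleftrightarrow>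
    length (pre \<eta> (u (-1)) (v @ w)) + left_length (length w) < left_length (length (v @ w))"
    (is "?P @ [?t] \<noteq> _ \<longleftrightarrow> _")
proof -
  have vv: "valid \<eta> (u (-1)) v" "valid \<eta> ?t w"
    using assms by (auto simp: valid_append)
  obtain r where r: "(\<eta> ^^ p) [u (-1)] = ?P @ [?t] @ r"
    using prefix_pre_target[OF vv(1)] assms by (auto simp: prefix_def)
  have "(\<eta> ^^ length (v @ w)) [u (-1)] = (\<eta> ^^ length w) ((\<eta> ^^ p) [u (-1)])"
    using assms by (simp add: funpow_add add.commute[of p])
  then have len: "left_length (length (v @ w)) = length ((\<eta> ^^ length w) ?P) +
      length ((\<eta> ^^ length w) [?t]) + length ((\<eta> ^^ length w) r)"
    unfolding r funpow_append by simp
  have lt: "length (pre \<eta> ?t w) < length ((\<eta> ^^ length w) [?t])"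
    by (rule length_pre_less[OF vv(2)])
  obtain r' where r': "(\<eta> ^^ p) [u (-1)] = r' @ [u (-1)]" using left_ends by blast
  show ?thesis
  proof (cases r rule: rev_cases)
    case Nil
    then have "?t = u (-1)" using r r' by simp
    then show ?thesis using len r Nil by (simp add: pre_append)
  next
    case (snoc ys y)
    then have "y = u (-1)" using r r' by simp
    then have "length ((\<eta> ^^ length w) r) \<ge> left_length (length w)"
      using snoc by (simp add: funpow_append)
    then show ?thesis using len lt r snoc by (simp add: pre_append)
  qed
qed

lemma W_max_spec:
  "valid \<eta> (u (-1)) (W_max \<eta> u)" "length (W_max \<eta> u) = p"
  "length (pre \<eta> (u (-1)) (W_max \<eta> u)) = left_length p - 1"
proof -
  have "left_length p - 1 < left_length p" using length_ge_1[of p "u (-1)"] by simp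
  then obtain v where v: "valid \<eta> (u (-1)) v" "length v = p"
    "length (pre \<eta> (u (-1)) v) = left_length p - 1" using ex_valid by blast
  have "W_max \<eta> u = v"
    unfolding W_max_def period_eq[symmetric] using v period_pos by (intro tail_eqI) auto
  with v show "valid \<eta> (u (-1)) (W_max \<eta> u)" "length (W_max \<eta> u) = p"
    "length (pre \<eta> (u (-1)) (W_max \<eta> u)) = left_length p - 1" by simp_all
qed

text \<open>\<open>W_max\<close> addresses the last letter, and a prefix of full length is the whole
  word.\<close>

lemma pre_eq_W_max_iff:
  assumes "valid \<eta> (u (-1)) v" "length v = p"
  shows "pre \<eta> (u (-1)) v @ [target \<eta> (u (-1)) v] = (\<eta> ^^ p) [u (-1)] \<longleftrightarrow> v = W_max \<eta> u"
proof -
  have "v = W_max \<eta> u \<longleftrightarrow> length (pre \<eta> (u (-1)) v) = left_length p - 1"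
    using W_max_spec assms pre_inj by metis
  also have "\<dots> \<longleftrightarrow> length (pre \<eta> (u (-1)) v @ [target \<eta> (u (-1)) v]) = left_length p"
    using length_ge_1[of p "u (-1)"] by auto
  also have "\<dots> \<longleftrightarrow> pre \<eta> (u (-1)) v @ [target \<eta> (u (-1)) v] = (\<eta> ^^ p) [u (-1)]"
    using prefix_pre_target[OF assms(1)] assms(2) by (metis prefix_def append_eq_append_conv append_Nil2)
  finally show ?thesis by simp
qed

lemma right_word_block:
  assumes "length v = p"
  shows "right_word (v @ w) \<longleftrightarrow> valid \<eta> (u 0) (v @ w) \<and> p dvd length w \<and>
    right_length (length w) \<le> length (pre \<eta> (u 0) (v @ w))"
proof -
  have "prefix (replicate p 0) (v @ w) \<longleftrightarrow> v = replicate p 0"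
    using assms by (auto simp: prefix_def)
  then show ?thesis using assms right_pre_block[of v w] by (auto simp: right_word_def)
qed

lemma left_word_block:
  assumes "length v = p"
  shows "left_word (v @ w) \<longleftrightarrow> valid \<eta> (u (-1)) (v @ w) \<and> p dvd length w \<and>
    length (pre \<eta> (u (-1)) (v @ w)) + left_length (length w) < left_length (length (v @ w))"
proof -
  have "prefix (W_max \<eta> u) (v @ w) \<longleftrightarrow> v = W_max \<eta> u"
    using assms W_max_spec(2) by (auto simp: prefix_def)
  then show ?thesis
    using assms left_pre_block[of v w] pre_eq_W_max_iff[of v]
    by (auto simp: left_word_def valid_append)
qed

section \<open>The value map and its monotonicity\<close>

text \<open>An analogue of two's complement: a leading 1 followed by \<open>k\<close> digits counts
  as \<open>- left_length k\<close>. In particular \<open>[0]\<close> has value 0 and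
  \<open>[1]\<close> has value -1.\<close>

definition value_of :: "nat list \<Rightarrow> int" where
  "value_of s = (if hd s = 0 then int (length (pre \<eta> (u 0) (tl s)))
     else int (length (pre \<eta> (u (-1)) (tl s))) - int (left_length (length (tl s))))"

lemma value_of_Cons [simp]:
  "value_of (0 # w) = int (length (pre \<eta> (u 0) w))"
  "value_of (1 # w) = int (length (pre \<eta> (u (-1)) w)) - int (left_length (length w))"
  "value_of (Suc 0 # w) = int (length (pre \<eta> (u (-1)) w)) - int (left_length (length w))"
  by (simp_all add: value_of_def)

text \<open>Distinct multiples of \<open>p\<close> differ by at least \<open>p\<close>: a shorter
  word is no longer than what remains of the longer one after its first block.\<close>

lemma dvd_less_imp_add_le: "p dvd i \<Longrightarrow> p dvd p + j \<Longrightarrow> i < p + j \<Longrightarrow> i \<le> j"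
proof -
  assume a: "p dvd i" "p dvd p + j" "i < p + j"
  then have "p dvd j" by (simp add: dvd_add_right_iff)
  with a obtain a b where "i = p * a" "j = p * b" by (auto elim!: dvdE)
  moreover from this a have "p * a < p * Suc b" by simp
  then have "a < Suc b" by (simp only: mult_less_cancel1)
  ultimately show ?thesis by simp
qed

text \<open>For different lengths, the excluded zero block pushes the longer word past
  \<open>right_length (length b)\<close>, which bounds every value of the shorter word.\<close>

lemma value_of_right_mono:
  assumes "right_word v" "right_word w" "less_rad (0 # v) (0 # w)"
  shows "length (pre \<eta> (u 0) v) < length (pre \<eta> (u 0) w)"
proof (cases "length v < length w")
  case True
  then have "w \<noteq> []" by auto
  then obtain a b where w: "w = a @ b" "length a = p" "p dvd length b"
    using split_block[of w] assms by (auto simp: right_word_def)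
  have "length v \<le> length b"
    using True w assms dvd_less_imp_add_le[of "length v" "length b"] by (auto simp: right_word_def)
  then have "right_length (length v) \<le> right_length (length b)" by (rule length_funpow_mono)
  moreover have "right_length (length b) \<le> length (pre \<eta> (u 0) w)"
    using assms w right_word_block by blast
  moreover have "length (pre \<eta> (u 0) v) < right_length (length v)"
    using assms length_pre_less by (auto simp: right_word_def)
  ultimately show ?thesis by linarith
next
  case False
  then show ?thesis using assms
    by (intro length_pre_strict_mono) (auto simp: right_word_def less_rad_def less_lex_def)
qed

text \<open>Here longer words lie further left, which is what \<open>less_rev\<close> expresses: the
  longer word falls below \<open>- left_length (length b)\<close>, a lower bound for the shorter
  one.\<close>

lemma value_of_left_mono:
  assumes "left_word v" "left_word w" "less_rev (1 # v) (1 # w)"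
  shows "value_of (1 # v) < value_of (1 # w)"
proof (cases "length w < length v")
  case True
  then have "v \<noteq> []" by auto
  then obtain a b where v: "v = a @ b" "length a = p" "p dvd length b"
    using split_block[of v] assms by (auto simp: left_word_def)
  have "length w \<le> length b"
    using True v assms dvd_less_imp_add_le[of "length w" "length b"] by (auto simp: left_word_def)
  then have "left_length (length w) \<le> left_length (length b)" by (rule length_funpow_mono)
  moreover have "length (pre \<eta> (u (-1)) v) + left_length (length b) < left_length (length v)"
    using assms v left_word_block by blast
  ultimately show ?thesis by simp
next
  case False
  then have "length v = length w" using assms by (auto simp: less_rev_def)
  moreover from this have "length (pre \<eta> (u (-1)) v) < length (pre \<eta> (u (-1)) w)" using assms
    by (intro length_pre_strict_mono) (auto simp: left_word_def less_rev_def less_lex_def)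
  ultimately show ?thesis by simp
qed

lemma value_of_left_neg: "left_word w \<Longrightarrow> value_of (1 # w) < 0"
  using length_pre_less by (auto simp: left_word_def)

lemma value_of_strict_mono:
  assumes "s \<in> rep_lang" "t \<in> rep_lang" "prec (digits \<eta>) s t"
  shows "value_of s < value_of t"
  using assms(1)
proof (cases s rule: rep_lang_cases)
  case s: (1 v)
  from assms(2) show ?thesis
  proof (cases t rule: rep_lang_cases)
    case (1 w)
    then have "less_rad (0 # v) (0 # w)"
      using s assms(3) hd_words_from unfolding prec_def by (metis zero_neq_one)
    then show ?thesis using s 1 value_of_right_mono[of v w] by simp
  next
    case (2 w)
    then show ?thesis using s assms(3) hd_words_from unfolding prec_def by (metis zero_neq_one)
  qed
next
  case s: (2 v)
  from assms(2) show ?thesis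
  proof (cases t rule: rep_lang_cases)
    case (1 w)
    then show ?thesis using value_of_left_neg[of v] s by simp
  next
    case (2 w)
    then have "less_rev (1 # v) (1 # w)"
      using s assms(3) hd_words_from unfolding prec_def by (metis zero_neq_one)
    then show ?thesis using s 2 value_of_left_mono[of v w] by simp
  qed
qed

text \<open>Totality lets strict monotonicity of \<open>value_of\<close> also yield injectivity and
  reflect the order.\<close>

lemma prec_total:
  assumes "s \<in> rep_lang" "t \<in> rep_lang"
  shows "prec (digits \<eta>) s t \<or> s = t \<or> prec (digits \<eta>) t s"
proof -
  have lin: "less_rad s t \<or> s = t \<or> less_rad t s" "less_rev s t \<or> s = t \<or> less_rev t s"
    using less_lex_linear[of s t] by (auto simp: less_rad_def less_rev_def)
  have shape: "s \<in> words_from {[0]} (digits \<eta>) \<or> s \<in> words_from {[1]} (digits \<eta>)"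
    if "s \<in> rep_lang" for s
    using that
  proof (cases s rule: rep_lang_cases)
    case (1 w)
    then have "s \<in> lists (digits \<eta>)"
      using valid_imp_digits digits_01 by (auto simp: right_word_def)
    with 1 show ?thesis by (simp add: mem_words_from_iff)
  next
    case (2 w)
    then have "s \<in> lists (digits \<eta>)"
      using valid_imp_digits digits_01 by (auto simp: left_word_def)
    with 2 show ?thesis by (simp add: mem_words_from_iff)
  qed
  show ?thesis using lin shape[OF assms(1)] shape[OF assms(2)] unfolding prec_def by argo
qed

lemma value_of_inj: "inj_on value_of rep_lang"
proof (rule inj_onI)
  fix s t assume "s \<in> rep_lang" "t \<in> rep_lang" "value_of s = value_of t"
  then show "s = t"
    using prec_total[of s t] value_of_strict_mono[of s t] value_of_strict_mono[of t s] by auto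
qed

section \<open>Defining sequences of representations as words of the language\<close>

lemma rep_seq_pos_iff:
  assumes "1 \<le> n"
  shows "rep_seq_pos \<eta> u n ms \<longleftrightarrow>
    (\<exists>w. right_word w \<and> value_of (0 # w) = n \<and> ms = seq \<eta> (u 0) w)"
proof -
  have key: "rep_seq_pos \<eta> u n (seq \<eta> (u 0) w) \<longleftrightarrow> right_word w \<and> value_of (0 # w) = n"
    if w: "valid \<eta> (u 0) w" "w \<noteq> []" "p dvd length w" for w
  proof -
    obtain a b where ab: "w = a @ b" "length a = p" "p dvd length b"
      using split_block w by metis
    have va: "valid \<eta> (u 0) a" using w ab by (simp add: valid_append)
    \<comment> \<open>\<open>seq\<close> places the first block of digits at the end of the
      list.\<close>
    have "drop (length w - p) (seq \<eta> (u 0) w) = seq \<eta> (u 0) a"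
      using ab by (simp add: seq_append)
    then have "concat (map (\<lambda>i. fst (seq \<eta> (u 0) w ! i)) (rev [length w - p..<length w])) \<noteq> []
        \<longleftrightarrow> a \<noteq> replicate p 0"
      using concat_map_rev_upt[of "seq \<eta> (u 0) w" "length w - p"]
        concat_fst_seq_eq_Nil[OF va] ab by simp
    also have "\<dots> \<longleftrightarrow> right_word w"
      using right_word_block[OF ab(2)] right_pre_block[of a b] w ab by auto
    finally have blk: "concat (map (\<lambda>i. fst (seq \<eta> (u 0) w ! i)) (rev [length w - p..<length w])) \<noteq> []
        \<longleftrightarrow> right_word w" .
    \<comment> \<open>Only lengths matter: once they agree, both words are prefixes of
      \<open>(\<eta> ^^ length w) [u 0]\<close>, which \<open>u\<close> spells out from position
      0.\<close>
    have "map u [0..n - 1] = pre \<eta> (u 0) w \<longleftrightarrow> int (length (pre \<eta> (u 0) w)) = n"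
    proof
      assume "map u [0..n - 1] = pre \<eta> (u 0) w"
      from arg_cong[OF this, of length] show "int (length (pre \<eta> (u 0) w)) = n"
        using assms by simp
    next
      assume n: "int (length (pre \<eta> (u 0) w)) = n"
      then have "n \<le> int (right_length (length w))" using length_pre_less[OF w(1)] by simp
      then have "[0..int (right_length (length w)) - 1] = [0..n - 1] @ [n..int (right_length (length w)) - 1]"
        using assms by (intro upto_split) auto
      then have "map u [0..n - 1] @ map u [n..int (right_length (length w)) - 1] = (\<eta> ^^ length w) [u 0]"
        using right_fixed[OF w(3)] by simp
      moreover obtain r where "(\<eta> ^^ length w) [u 0] = pre \<eta> (u 0) w @ r"
        using prefix_pre_target[OF w(1)] by (auto simp: prefix_def)
      moreover have "length (map u [0..n - 1]) = length (pre \<eta> (u 0) w)" using n by simp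
      ultimately show "map u [0..n - 1] = pre \<eta> (u 0) w" by (metis append_eq_append_conv)
    qed
    then show ?thesis
      using w admissible_seq[of \<eta> "u 0" w] blk
      unfolding rep_seq_pos_def Let_def period_eq[symmetric] expansion_seq length_seq by auto
  qed
  show ?thesis
  proof
    assume r: "rep_seq_pos \<eta> u n ms"
    then have adm: "admissible \<eta> (u 0) ms" and dv: "p dvd length ms"
      by (auto simp: rep_seq_pos_def Let_def period_eq)
    from admissible_imp_seq[OF adm]
    have s: "valid \<eta> (u 0) (digit_word ms)" "seq \<eta> (u 0) (digit_word ms) = ms" by auto
    have "ms \<noteq> []" using adm by (simp add: admissible_def)
    then have "digit_word ms \<noteq> []" "length (digit_word ms) = length ms"
      by (auto simp: digit_word_def)
    then show "\<exists>w. right_word w \<and> value_of (0 # w) = n \<and> ms = seq \<eta> (u 0) w"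
      using key[of "digit_word ms"] s r dv by metis
  next
    assume "\<exists>w. right_word w \<and> value_of (0 # w) = n \<and> ms = seq \<eta> (u 0) w"
    then obtain w where w: "right_word w" "value_of (0 # w) = n" "ms = seq \<eta> (u 0) w" by blast
    \<comment> \<open>The empty word has value 0, which \<open>1 \<le> n\<close> excludes.\<close>
    then have "w \<noteq> []" using assms by auto
    then show "rep_seq_pos \<eta> u n ms" using key[of w] w by (auto simp: right_word_def)
  qed
qed

lemma rep_seq_neg_iff:
  assumes "n \<le> -2"
  shows "rep_seq_neg \<eta> u n ms \<longleftrightarrow>
    (\<exists>w. left_word w \<and> value_of (1 # w) = n \<and> ms = seq \<eta> (u (-1)) w)"
proof -
  let ?x = "u (-1)"
  have key: "rep_seq_neg \<eta> u n (seq \<eta> ?x w) \<longleftrightarrow> left_word w \<and> value_of (1 # w) = n"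
    if w: "valid \<eta> ?x w" "w \<noteq> []" "p dvd length w" for w
  proof -
    obtain a b where ab: "w = a @ b" "length a = p" "p dvd length b"
      using split_block w by metis
    have "a \<noteq> []" using ab period_pos by auto
    have dr: "drop (length w - p) (seq \<eta> ?x w) = seq \<eta> ?x a"
      using ab by (simp add: seq_append)
    \<comment> \<open>The letter at index \<open>length w - p\<close> is the one reached after the
      first block \<open>a\<close>.\<close>
    then have "seq \<eta> ?x w ! (length w - p) = seq \<eta> ?x a ! 0"
      using ab by (simp add: seq_append nth_append)
    then have blk: "expansion \<eta> (drop (length w - p) (seq \<eta> ?x w)) @ [snd (seq \<eta> ?x w ! (length w - p))]
        \<noteq> (\<eta> ^^ p) [?x] \<longleftrightarrow> left_word w"
      using left_word_block[OF ab(2)] left_pre_block[of a b] w ab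
      unfolding dr expansion_seq by (simp add: snd_hd_seq[OF \<open>a \<noteq> []\<close>])
    let ?N = "int (left_length (length w))"
    have "- ?N \<le> n \<and> map u [- ?N..n - 1] = pre \<eta> ?x w \<longleftrightarrow> int (length (pre \<eta> ?x w)) - ?N = n"
    proof
      assume *: "- ?N \<le> n \<and> map u [- ?N..n - 1] = pre \<eta> ?x w"
      then have "length (map u [- ?N..n - 1]) = length (pre \<eta> ?x w)" by simp
      \<comment> \<open>The bound \<open>- ?N \<le> n\<close> ensures that \<open>nat\<close> does
        not truncate.\<close>
      then have "nat (n + ?N) = length (pre \<eta> ?x w)" by simp
      then show "int (length (pre \<eta> ?x w)) - ?N = n" using * by linarith
    next
      assume n: "int (length (pre \<eta> ?x w)) - ?N = n"
      then have "[- ?N..0 - 1] = [- ?N..n - 1] @ [n..0 - 1]"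
        using assms by (intro upto_split) auto
      then have "map u [- ?N..n - 1] @ map u [n..-1] = (\<eta> ^^ length w) [?x]"
        using left_fixed[OF w(3)] by simp
      moreover obtain r where "(\<eta> ^^ length w) [?x] = pre \<eta> ?x w @ r"
        using prefix_pre_target[OF w(1)] by (auto simp: prefix_def)
      moreover have "length (map u [- ?N..n - 1]) = length (pre \<eta> ?x w)" using n by simp
      ultimately have "map u [- ?N..n - 1] = pre \<eta> ?x w" by (metis append_eq_append_conv)
      then show "- ?N \<le> n \<and> map u [- ?N..n - 1] = pre \<eta> ?x w" using n by simp
    qed
    then show ?thesis
      using w admissible_seq[of \<eta> ?x w] blk
      unfolding rep_seq_neg_def Let_def period_eq[symmetric] expansion_seq length_seq value_of_Cons
      by blast
  qed
  show ?thesis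
  proof
    assume r: "rep_seq_neg \<eta> u n ms"
    then have adm: "admissible \<eta> ?x ms" and dv: "p dvd length ms"
      by (auto simp: rep_seq_neg_def Let_def period_eq)
    from admissible_imp_seq[OF adm]
    have s: "valid \<eta> ?x (digit_word ms)" "seq \<eta> ?x (digit_word ms) = ms" by auto
    have "ms \<noteq> []" using adm by (simp add: admissible_def)
    then have "digit_word ms \<noteq> []" "length (digit_word ms) = length ms"
      by (auto simp: digit_word_def)
    then show "\<exists>w. left_word w \<and> value_of (1 # w) = n \<and> ms = seq \<eta> ?x w"
      using key[of "digit_word ms"] s r dv by metis
  next
    assume "\<exists>w. left_word w \<and> value_of (1 # w) = n \<and> ms = seq \<eta> ?x w"
    then obtain w where w: "left_word w" "value_of (1 # w) = n" "ms = seq \<eta> ?x w" by blast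
    \<comment> \<open>The empty word has value -1, which \<open>n \<le> -2\<close> excludes.\<close>
    then have "w \<noteq> []" using assms by auto
    then show "rep_seq_neg \<eta> u n ms" using key[of w] w by (auto simp: left_word_def)
  qed
qed

section \<open>Every integer is represented\<close>

lemma ex_right_word:
  assumes "1 \<le> n"
  shows "\<exists>w. right_word w \<and> value_of (0 # w) = n"
proof -
  \<comment> \<open>The fewest blocks whose image of \<open>u 0\<close> covers position
    \<open>n\<close>. Minimality puts \<open>n\<close> outside the image with one block fewer, so
    the leading block is not all zeros.\<close>
  define l where "l = (LEAST l. nat n < right_length (l * p))"
  have l: "nat n < right_length (l * p)"
    unfolding l_def using growing_imp_unbounded[OF growing_right period_pos] by (rule LeastI_ex)
  have "l \<noteq> 0" using l assms by (intro notI) simp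
  then obtain j where j: "l = Suc j" by (cases l) auto
  then have min: "right_length (j * p) \<le> nat n"
    using not_less_Least[of j "\<lambda>l. nat n < right_length (l * p)"] unfolding l_def[symmetric] by simp
  obtain w where w: "valid \<eta> (u 0) w" "length w = l * p" "length (pre \<eta> (u 0) w) = nat n"
    using ex_valid[OF l] by blast
  have "w \<noteq> []" using w j period_pos by auto
  then obtain a b where ab: "w = a @ b" "length a = p" "p dvd length b"
    using split_block[of w] w by auto
  then have "length b = j * p" using w j by simp
  then have "right_word w" using right_word_block[OF ab(2), of b] ab w min by simp
  with w assms show ?thesis by auto
qed

lemma ex_left_word:
  assumes "n \<le> -2"
  shows "\<exists>w. left_word w \<and> value_of (1 # w) = n"
proof -
  \<comment> \<open>\<open>- n - 1\<close> is the distance from position \<open>n\<close> to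
    position -1. The least sufficient number of blocks again makes the leading block admissible, now
    different from \<open>W_max\<close>.\<close>
  define l where "l = (LEAST l. nat (- n - 1) < left_length (l * p))"
  have l: "nat (- n - 1) < left_length (l * p)"
    unfolding l_def using growing_imp_unbounded[OF growing_left period_pos] by (rule LeastI_ex)
  have "l \<noteq> 0" using l assms by (intro notI) simp
  then obtain j where j: "l = Suc j" by (cases l) auto
  then have min: "left_length (j * p) \<le> nat (- n - 1)"
    using not_less_Least[of j "\<lambda>l. nat (- n - 1) < left_length (l * p)"] unfolding l_def[symmetric] by simp
  \<comment> \<open>The same position counted from the left end of the image, as \<open>pre\<close>
    measures it.\<close>
  have "nat (int (left_length (l * p)) + n) < left_length (l * p)" using assms l by linarith
  from ex_valid[OF this] obtain w where w: "valid \<eta> (u (-1)) w" "length w = l * p"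
    "length (pre \<eta> (u (-1)) w) = nat (int (left_length (l * p)) + n)" by blast
  have val: "int (length (pre \<eta> (u (-1)) w)) = int (left_length (l * p)) + n"
    using w(3) l assms by linarith
  have "w \<noteq> []" using w j period_pos by auto
  then obtain a b where ab: "w = a @ b" "length a = p" "p dvd length b"
    using split_block[of w] w by auto
  then have b: "length b = j * p" using w j by simp
  have "length (pre \<eta> (u (-1)) w) + left_length (length b) < left_length (length w)"
    unfolding b w(2) using val min assms by linarith
  then have "left_word w" using left_word_block[OF ab(2), of b] ab w by simp
  with w val show ?thesis by auto
qed

text \<open>The forbidden blocks have positive length, so \<open>[0]\<close> and \<open>[1]\<close>
  survive; they represent 0 and -1.\<close>

lemma Nil_right_word_left_word: "right_word []" "left_word []"
  using period_pos W_max_spec(2) by (auto simp: right_word_def left_word_def)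

section \<open>The representation map as inverse of the value map\<close>

lemma rep_correct: "rep \<eta> u n \<in> rep_lang \<and> value_of (rep \<eta> u n) = n"
proof -
  consider "1 \<le> n" | "n = 0" | "n = -1" | "n \<le> -2" by linarith
  then show ?thesis
  proof cases
    case 1
    then obtain w where w: "right_word w" "value_of (0 # w) = n" using ex_right_word by blast
    \<comment> \<open>Injectivity of \<open>value_of\<close> across all lengths gives the uniqueness
      that the definite description in \<open>rep\<close> requires.\<close>
    have uniq: "v = w" if "right_word v" "value_of (0 # v) = n" for v
      using inj_onD[OF value_of_inj, of "0 # v" "0 # w"] that w by (simp add: mem_rep_lang_iff)
    have "(THE ms. rep_seq_pos \<eta> u n ms) = seq \<eta> (u 0) w"
      unfolding rep_seq_pos_iff[OF 1] using w uniq by (intro the_equality) blast+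
    then have "rep \<eta> u n = 0 # w"
      using 1 w digit_word_seq[of \<eta> "u 0" w] by (simp add: rep_def right_word_def)
    with w show ?thesis by (simp add: mem_rep_lang_iff)
  next
    case 4
    then obtain w where w: "left_word w" "value_of (1 # w) = n" using ex_left_word by blast
    have uniq: "v = w" if "left_word v" "value_of (1 # v) = n" for v
      using inj_onD[OF value_of_inj, of "1 # v" "1 # w"] that w by (simp add: mem_rep_lang_iff)
    have "(THE ms. rep_seq_neg \<eta> u n ms) = seq \<eta> (u (-1)) w"
      unfolding rep_seq_neg_iff[OF 4] using w uniq by (intro the_equality) blast+
    then have "rep \<eta> u n = 1 # w"
      using 4 w digit_word_seq[of \<eta> "u (-1)" w] by (simp add: rep_def left_word_def)
    with w show ?thesis by (simp add: mem_rep_lang_iff)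
  qed (use Nil_right_word_left_word in \<open>auto simp: rep_def mem_rep_lang_iff\<close>)
qed

lemma range_rep: "range (rep \<eta> u) = rep_lang"
proof
  show "range (rep \<eta> u) \<subseteq> rep_lang" using rep_correct by blast
  show "rep_lang \<subseteq> range (rep \<eta> u)"
  proof
    fix s assume "s \<in> rep_lang"
    \<comment> \<open>Both words lie in the language and have the same value.\<close>
    then have "s = rep \<eta> u (value_of s)"
      using rep_correct[of "value_of s"] inj_onD[OF value_of_inj, of s "rep \<eta> u (value_of s)"] by simp
    then show "s \<in> range (rep \<eta> u)" by blast
  qed
qed

lemma rep_increasing: "m < n \<Longrightarrow> prec (digits \<eta>) (rep \<eta> u m) (rep \<eta> u n)"
  using prec_total[of "rep \<eta> u m" "rep \<eta> u n"] value_of_strict_mono[of "rep \<eta> u n" "rep \<eta> u m"]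
    rep_correct[of m] rep_correct[of n] by auto

end

section \<open>Rigidity of the integers and the characterization\<close>

text \<open>A preimage of \<open>g k + 1\<close> lies beyond \<open>k\<close> and, since
  \<open>g (k + 1)\<close> is at least \<open>g k + 1\<close>, not beyond \<open>k + 1\<close>. So
  \<open>g\<close> advances by exactly 1 in both directions from 0.\<close>

lemma strict_mono_surj_int_eq_id:
  fixes g :: "int \<Rightarrow> int"
  assumes mono: "strict_mono g" and surj: "surj g" and zero: "g 0 = 0"
  shows "g n = n"
proof -
  have Suc: "g (k + 1) = g k + 1" for k
  proof -
    obtain j where j: "g j = g k + 1" using surj by (metis surjD)
    then have "k < j" using strict_mono_less[OF mono, of k j] by simp
    moreover have "g k < g (k + 1)" using strict_mono_less[OF mono, of k "k + 1"] by simp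
    then have "j \<le> k + 1" using j strict_mono_less_eq[OF mono, of j "k + 1"] by simp
    ultimately have "j = k + 1" by simp
    with j show ?thesis by simp
  qed
  show ?thesis
  proof (induction n rule: int_induct[of _ 0])
    case (step1 i)
    then show ?case by (simp add: Suc)
  next
    case (step2 i)
    then show ?case using Suc[of "i - 1"] by simp
  qed (rule zero)
qed

theorem theorem22:
  fixes \<eta> :: "'a::finite list \<Rightarrow> 'a list"
    and u :: "int \<Rightarrow> 'a"
    and p :: nat
    and f :: "int \<Rightarrow> nat list"
  assumes "substitution \<eta>"
    and "periodic_point \<eta> u"
    and "growing \<eta> (u (-1))" and "growing \<eta> (u 0)"
    and "p = period \<eta> u"
    and "\<forall>n. f n \<in> words_from {[0], [1]} (digits \<eta>)"
  shows "f = rep \<eta> u \<longleftrightarrow>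
    (\<forall>m n. m < n \<longrightarrow> prec (digits \<eta>) (f m) (f n)) \<and>
    range f =
      (\<Union>l::nat. lang \<eta> (u (-1), u 0) (l * p + 1))
        - words_from {0 # W_min \<eta> u, 1 # W_max \<eta> u} (digits \<eta>) \<and>
    f 0 = [0]"
proof -
  have "\<exists>q. 1 \<le> q \<and> (act \<eta> ^^ q) u = u" using assms(2) by (auto simp: periodic_point_def)
  then have per: "1 \<le> p \<and> (act \<eta> ^^ p) u = u"
    unfolding assms(5) period_def by (rule LeastI_ex)
  interpret periodic_seed \<eta> u p
    using assms per by unfold_locales (auto simp: substitution_def)
  show ?thesis
    unfolding rep_lang_def[symmetric]
  proof
    assume "f = rep \<eta> u"
    then show "(\<forall>m n. m < n \<longrightarrow> prec (digits \<eta>) (f m) (f n)) \<and> range f = rep_lang \<and> f 0 = [0]"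
      using rep_increasing range_rep by (simp add: rep_def)
  next
    assume f: "(\<forall>m n. m < n \<longrightarrow> prec (digits \<eta>) (f m) (f n)) \<and> range f = rep_lang \<and> f 0 = [0]"
    then have mem: "f n \<in> rep_lang" for n by blast
    \<comment> \<open>Composing with \<open>value_of\<close> moves the problem to the integers,
      where order and surjectivity leave only the translations and \<open>f 0 = [0]\<close> selects
      the identity.\<close>
    have "value_of (f n) = n" for n
    proof (rule strict_mono_surj_int_eq_id[of "\<lambda>n. value_of (f n)"])
      show "strict_mono (\<lambda>n. value_of (f n))"
        using f mem value_of_strict_mono by (auto intro!: strict_monoI)
      show "surj (\<lambda>n. value_of (f n))"
        unfolding surj_def
      proof
        fix n
        \<comment> \<open>Every integer is attained because \<open>f\<close> hits its
          representation.\<close>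
        have "rep \<eta> u n \<in> range f" using f rep_correct by blast
        then show "\<exists>m. n = value_of (f m)" using rep_correct[of n] by (metis imageE)
      qed
      show "value_of (f 0) = 0" using f by simp
    qed
    then show "f = rep \<eta> u"
      using inj_onD[OF value_of_inj, of "f n" "rep \<eta> u n" for n] mem rep_correct by (intro ext) simp
  qed
qed

end
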